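(* For $0<x<e$ define $$\beta_0(x)=\frac{x}{e},\qquad \beta_{n+1}(x)=\frac{\beta_n(x)}{1+\beta_n(x)}\left(1+\ln\left(\frac{x}{\beta_n(x)}\right)\right)\quad(n\in\mathbb{N}),$$ and let $\kappa_2=1-1/e$. Then for every integer $n\ge1$ and every $0<x<e$, $$0<\mathrm{W}_0(x)-\beta_n(x)<\frac15\cdot\kappa_2^{-1+2^n}<\frac15\cdot\left(\frac{633}{1000}\right)^{-1+2^n}.$$
   Context: $\mathbb{N}=\{0,1,2,\ldots\}$. $\mathrm{W}_0:[-1/e,\infty)\to[-1,\infty)$ is the principal real branch of the Lambert function: $\mathrm{W}_0(x)$ is the unique $w\ge -1$ with $we^w=x$. *)

theory Defs
  imports Complex_Main
begin

text \<open>Principal real branch of the Lambert function; meaningful only for \<open>x \<ge> - exp (- 1)\<close>,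
  where the described \<open>w\<close> exists uniquely.\<close>

definition lambert_W0 :: "real \<Rightarrow> real" where
  "lambert_W0 x = (THE w. w \<ge> - 1 \<and> w * exp w = x)"

primrec lambert_beta :: "nat \<Rightarrow> real \<Rightarrow> real" where
  "lambert_beta 0 x = x / exp 1"
| "lambert_beta (Suc n) x =
     lambert_beta n x / (1 + lambert_beta n x) * (1 + ln (x / lambert_beta n x))"

definition kappa2 :: real where
  "kappa2 = 1 - 1 / exp 1"

end

(* Let w = W0 x and let d n = (w - beta n x) / w be the relative error, so that
   beta n x = w * (1 - d n). Since x = w * exp w, one step of the iteration reads
   d (n+1) = (d n + (1 - d n) * ln (1 - d n)) / (1 + beta n x), which is positive and, by
   ln t <= t - 1, at most (d n)^2. As d 0 = 1 - exp (w - 1) < kappa2, this gives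
   d 1 <= kappa2^2 and w * d n <= (w * d 1) * (kappa2^2)^(2^(n-1) - 1); the constant 1/5 comes
   from w * d 1 <= w * (d 0)^2 < kappa2 / 5. *)

theory Submission imports Defs begin

text \<open>Any competitor \<open>y\<close> has \<open>y * exp y > 0\<close>, hence
  \<open>y > 0\<close>, so monotonicity is needed only on the positive reals, not on all of [-1,
  \<infinity>).\<close>

lemma lambert_W0_mult_exp:
  assumes "0 < w"
  shows "lambert_W0 (w * exp w) = w"
  unfolding lambert_W0_def
proof (rule the_equality)
  fix y assume y: "y \<ge> - 1 \<and> y * exp y = w * exp w"
  have "0 < y * exp y" using y assms by simp
  then have "0 < y" by (simp add: zero_less_mult_iff)
  show "y = w"
  proof (rule linorder_cases[of y w])
    assume "y < w"
    then have "y * exp y < w * exp w" using \<open>0 < y\<close> by (intro mult_strict_mono) auto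
    then show ?thesis using y by simp
  next
    assume "w < y"
    then have "w * exp w < y * exp y" using assms by (intro mult_strict_mono) auto
    then show ?thesis using y by simp
  qed
qed (use assms in auto)

lemma mult_exp_surj:
  fixes x :: real
  assumes "0 < x" "x < exp 1"
  obtains w where "0 < w" "w < 1" "x = w * exp w"
proof -
  have "\<exists>w\<ge>0. w \<le> 1 \<and> w * exp w = x"
    by (rule IVT') (use assms in \<open>auto intro!: continuous_intros\<close>)
  then obtain w where "0 \<le> w" "w \<le> 1" "w * exp w = x" by blast
  moreover from this have "w \<noteq> 0" "w \<noteq> 1" using assms by auto
  ultimately show thesis using that[of w] by auto
qed

text \<open>Taking \<open>w\<close> rather than \<open>x\<close> as the argument keeps the
  \<open>THE\<close> of \<open>lambert_W0\<close> out of the error analysis.\<close>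

definition lambert_rel_err :: "nat \<Rightarrow> real \<Rightarrow> real" where
  "lambert_rel_err n w = 1 - lambert_beta n (w * exp w) / w"

lemma lambert_beta_eq:
  assumes "0 < w"
  shows "lambert_beta n (w * exp w) = w * (1 - lambert_rel_err n w)"
  using assms by (simp add: lambert_rel_err_def)

lemma lambert_rel_err_0: "0 < w \<Longrightarrow> lambert_rel_err 0 w = 1 - exp (w - 1)"
  by (simp add: lambert_rel_err_def exp_diff)

lemma lambert_rel_err_Suc:
  fixes w :: real
  defines "d n \<equiv> lambert_rel_err n w"
  assumes "0 < w" "d n < 1"
  shows "d (Suc n) = (d n + (1 - d n) * ln (1 - d n)) / (1 + w * (1 - d n))"
proof -
  define b where "b = w * (1 - d n)"
  have "0 < b" using assms(2,3) by (simp add: b_def)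
  have "ln (w * exp w / b) = ln (exp w / (1 - d n))"
    using assms(2) by (simp add: b_def)
  also have "\<dots> = w - ln (1 - d n)"
    using assms(3) by (simp add: ln_div)
  finally have ln: "ln (w * exp w / b) = w - ln (1 - d n)" .
  have "lambert_beta n (w * exp w) = b"
    using assms(2) by (simp add: lambert_beta_eq b_def d_def)
  then have "lambert_beta (Suc n) (w * exp w) = b / (1 + b) * (1 + (w - ln (1 - d n)))"
    by (simp add: ln)
  then have "d (Suc n) = 1 - b / (1 + b) * (1 + (w - ln (1 - d n))) / w"
    unfolding d_def[of "Suc n"] lambert_rel_err_def[of "Suc n"] by simp
  also have "\<dots> = 1 - (1 - d n) / (1 + b) * (1 + (w - ln (1 - d n)))"
    using assms(2) by (simp add: b_def)
  also have "\<dots> = (1 + b - (1 - d n) * (1 + (w - ln (1 - d n)))) / (1 + b)"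
    using \<open>0 < b\<close> by (simp add: field_simps)
  \<comment> \<open>The terms \<open>b\<close> and \<open>(1 - d n) * w\<close> cancel, so
    \<open>w\<close> survives only in the denominator.\<close>
  also have "1 + b - (1 - d n) * (1 + (w - ln (1 - d n))) = d n + (1 - d n) * ln (1 - d n)"
    by (simp add: b_def algebra_simps)
  finally show ?thesis by (simp add: b_def)
qed

text \<open>Both bounds come from ln t \<le> t - 1: at t = 1 / (1 - d), where it is strict because t
  \<noteq> 1, for positivity, and at t = 1 - d for the square.\<close>

lemma xlnx_remainder_bounds:
  fixes d :: real
  assumes "0 < d" "d < 1"
  shows "0 < d + (1 - d) * ln (1 - d)" "d + (1 - d) * ln (1 - d) \<le> d\<^sup>2"
proof -
  have "ln (1 / (1 - d)) < 1 / (1 - d) - 1"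
    using ln_le_minus_one[of "1 / (1 - d)"] ln_eq_minus_one[of "1 / (1 - d)"] assms by fastforce
  then have "- ln (1 - d) < d / (1 - d)"
    using assms by (simp add: ln_div field_simps)
  then show "0 < d + (1 - d) * ln (1 - d)"
    using assms by (simp add: field_simps)
  have "(1 - d) * ln (1 - d) \<le> (1 - d) * (- d)"
    using ln_le_minus_one[of "1 - d"] assms by (intro mult_left_mono) auto
  then show "d + (1 - d) * ln (1 - d) \<le> d\<^sup>2"
    by (simp add: algebra_simps power2_eq_square)
qed

lemma lambert_rel_err_Suc_bounds:
  assumes "0 < w" "0 < lambert_rel_err n w" "lambert_rel_err n w < 1"
  shows "0 < lambert_rel_err (Suc n) w"
    and "lambert_rel_err (Suc n) w \<le> (lambert_rel_err n w)\<^sup>2"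
proof -
  define d where "d = lambert_rel_err n w"
  note r = xlnx_remainder_bounds[OF assms(2,3), folded d_def]
  have D: "0 < w * (1 - d)" using assms by (simp add: d_def)
  have eq: "lambert_rel_err (Suc n) w = (d + (1 - d) * ln (1 - d)) / (1 + w * (1 - d))"
    using lambert_rel_err_Suc[OF assms(1,3)] by (simp add: d_def)
  show "0 < lambert_rel_err (Suc n) w" unfolding eq using r D by simp
  have "(d + (1 - d) * ln (1 - d)) / (1 + w * (1 - d)) \<le> d + (1 - d) * ln (1 - d)"
    using r(1) D by (simp add: divide_le_eq)
  then show "lambert_rel_err (Suc n) w \<le> (lambert_rel_err n w)\<^sup>2"
    using r(2) eq by (simp add: d_def)
qed

lemma lambert_rel_err_range:
  assumes "0 < w" "w < 1"
  shows "0 < lambert_rel_err n w \<and> lambert_rel_err n w < 1"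
proof (induction n)
  case 0
  then show ?case using assms by (simp add: lambert_rel_err_0)
next
  case (Suc n)
  then have "(lambert_rel_err n w)\<^sup>2 < 1"
    by (simp add: power_less_one_iff)
  then show ?case
    using lambert_rel_err_Suc_bounds[of w n] Suc assms by auto
qed

text \<open>Squaring is iterated from index 1, not 0, because the constant 1/5 needs a factor
  \<open>lambert_rel_err 1 w\<close> to pair with \<open>w\<close>.\<close>

lemma lambert_rel_err_Suc_le_power:
  assumes "0 < w" "w < 1"
  shows "lambert_rel_err (Suc m) w \<le> lambert_rel_err 1 w ^ (2 ^ m)"
proof (induction m)
  case (Suc m)
  have "lambert_rel_err (Suc (Suc m)) w \<le> (lambert_rel_err (Suc m) w)\<^sup>2"
    using lambert_rel_err_Suc_bounds(2) lambert_rel_err_range assms by blast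
  also have "\<dots> \<le> (lambert_rel_err 1 w ^ (2 ^ m))\<^sup>2"
    using Suc lambert_rel_err_range[OF assms, of "Suc m"] by (intro power_mono) auto
  finally show ?case by (simp add: power_mult[symmetric] mult.commute)
qed simp

lemma cubic_bound:
  fixes w :: real
  assumes "0 < w" "w < 1"
  shows "w * (1 - ((1 + w) / 2)\<^sup>2)\<^sup>2 < 3/25"
proof -
  (* Replacing (1 - w) * (3 + w) by its tangent line a - u at w = 2/5 leaves u * (a - u)^2,
     which AM-GM bounds by 4/27 * a^3. *)
  define u where "u = 14/5 * w"
  define a :: real where "a = 79/25"
  \<comment> \<open>This square is exactly \<open>(a - u) - (1 - w) * (3 + w)\<close>. The tangent
    point 2/5 approximates the maximiser of the left-hand side, near 0.38.\<close>
  have "0 \<le> (w - 2/5)\<^sup>2" by simp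
  then have "1 - ((1 + w) / 2)\<^sup>2 \<le> (a - u) / 4"
    by (simp add: u_def a_def power2_eq_square field_simps)
  moreover have "((1 + w) / 2)\<^sup>2 \<le> 1"
    using assms by (intro power_le_one) auto
  ultimately have "(1 - ((1 + w) / 2)\<^sup>2)\<^sup>2 \<le> ((a - u) / 4)\<^sup>2"
    by (intro power_mono) auto
  then have "w * (1 - ((1 + w) / 2)\<^sup>2)\<^sup>2 \<le> w * ((a - u) / 4)\<^sup>2"
    using assms by simp
  also have "\<dots> = 5/224 * (u * (a - u)\<^sup>2)"
    by (simp add: u_def power_divide)
  \<comment> \<open>The maximum over u in [0, a] is at u = a/3, hence the double root; the cofactor
    is positive since u < 14/5 < 4*a/3.\<close>
  also have "u * (a - u)\<^sup>2 = 4/27 * a^3 - (u - a/3)\<^sup>2 * (4*a/3 - u)"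
    by (simp add: power2_eq_square power3_eq_cube field_simps)
  also have "5/224 * \<dots> \<le> 5/224 * (4/27 * a^3)"
    using assms by (simp add: u_def a_def)
  also have "\<dots> < 3/25" by (simp add: a_def power_divide)
  finally show ?thesis .
qed

lemma kappa2_bounds: "3/5 < kappa2" "kappa2 < 633/1000"
proof -
  \<comment> \<open>The lower bound amounts to e > 5/2, and (9/8)^8 already exceeds 5/2.\<close>
  have "(1 + 1/8 :: real) ^ 8 \<le> exp (1/8) ^ 8"
    by (intro power_mono) (use exp_ge_add_one_self[of "1/8"] in auto)
  also have "exp (1/8 :: real) ^ 8 = exp 1"
    by (simp flip: exp_of_nat_mult)
  finally show "3/5 < kappa2"
    by (simp add: kappa2_def power_divide field_simps)
  \<comment> \<open>An even number of Taylor terms makes the remainder nonnegative, so the partial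
    sum bounds 1/e from below.\<close>
  obtain t :: real where "exp (- 1) = (\<Sum>m<8. (- 1) ^ m / fact m) + exp t / fact 8 * (- 1) ^ 8"
    using Maclaurin_exp_le[of "- 1" 8] by blast
  then have "exp (- 1 :: real) \<ge> (\<Sum>m<8. (- 1) ^ m / fact m)" by simp
  then show "kappa2 < 633/1000"
    by (simp add: kappa2_def exp_minus inverse_eq_divide eval_nat_numeral)
qed

lemma lambert_rel_err_1_bounds:
  assumes "0 < w" "w < 1"
  shows "lambert_rel_err 1 w \<le> kappa2\<^sup>2" "w * lambert_rel_err 1 w < kappa2 / 5"
proof -
  let ?d = "1 - exp (w - 1)"
  have step: "lambert_rel_err 1 w \<le> ?d\<^sup>2"
    using lambert_rel_err_Suc_bounds(2)[of w 0] lambert_rel_err_range[OF assms, of 0] assms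
    by (simp add: lambert_rel_err_0)
  have d: "0 \<le> ?d" using assms by simp
  have "exp (- 1) \<le> exp (w - 1)" using assms by simp
  then have "?d \<le> kappa2" by (simp add: kappa2_def exp_minus inverse_eq_divide)
  then have "?d\<^sup>2 \<le> kappa2\<^sup>2" using d by (intro power_mono) auto
  then show "lambert_rel_err 1 w \<le> kappa2\<^sup>2" using step by simp
  \<comment> \<open>Squaring exp t \<ge> 1 + t at t = (w - 1) / 2 reduces the claim to
    \<open>cubic_bound\<close>, whose 3/25 is one fifth of the lower bound 3/5 for
    \<open>kappa2\<close>.\<close>
  have "((1 + w) / 2)\<^sup>2 \<le> (exp ((w - 1) / 2))\<^sup>2"
    using exp_ge_add_one_self[of "(w - 1) / 2"] assms by (intro power_mono) (auto simp: field_simps)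
  also have "\<dots> = exp (w - 1)" by (simp flip: exp_of_nat_mult)
  finally have "?d\<^sup>2 \<le> (1 - ((1 + w) / 2)\<^sup>2)\<^sup>2" using d by (intro power_mono) auto
  then have "w * lambert_rel_err 1 w \<le> w * (1 - ((1 + w) / 2)\<^sup>2)\<^sup>2"
    using step assms by (intro mult_left_mono) auto
  then show "w * lambert_rel_err 1 w < kappa2 / 5"
    using cubic_bound[OF assms] kappa2_bounds by simp
qed

theorem theorem4p9:
  fixes x :: real and n :: nat
  assumes "0 < x" and "x < exp 1" and "n \<ge> 1"
  shows "0 < lambert_W0 x - lambert_beta n x
       \<and> lambert_W0 x - lambert_beta n x < 1 / 5 * kappa2 ^ (2 ^ n - 1)
       \<and> 1 / 5 * kappa2 ^ (2 ^ n - 1) < 1 / 5 * (633 / 1000) ^ (2 ^ n - 1)"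
proof -
  obtain w where w: "0 < w" "w < 1" "x = w * exp w"
    using mult_exp_surj assms by blast
  obtain m where n: "n = Suc m" using assms(3) by (cases n) auto
  let ?d = "\<lambda>n. lambert_rel_err n w"
  have err: "lambert_W0 x - lambert_beta n x = w * ?d n"
    using w by (simp add: lambert_W0_mult_exp lambert_beta_eq algebra_simps)
  have k: "0 < kappa2" using kappa2_bounds by simp
  \<comment> \<open>The exponent 2^n - 1 = 2*p + 1 splits into one \<open>kappa2\<close> from the
    bound on \<open>w * ?d 1\<close> and p factors \<open>kappa2\<^sup>2\<close> from the remaining
    powers of \<open>?d 1\<close>.\<close>
  define p :: nat where "p = 2 ^ m - 1"
  have p: "2 ^ m = Suc p" by (simp add: p_def)
  then have p': "2 ^ n - 1 = Suc (2 * p)" by (simp add: n)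
  have "w * ?d n \<le> w * ?d 1 ^ Suc p"
    using lambert_rel_err_Suc_le_power[of w m] w by (simp add: n p)
  also have "\<dots> = w * ?d 1 * ?d 1 ^ p" by simp
  also have "\<dots> \<le> w * ?d 1 * (kappa2\<^sup>2) ^ p"
    using lambert_rel_err_1_bounds(1)[of w] lambert_rel_err_range[of w 1] w
    by (intro mult_left_mono power_mono) auto
  also have "\<dots> < kappa2 / 5 * (kappa2\<^sup>2) ^ p"
    using lambert_rel_err_1_bounds(2)[of w] w k by (intro mult_strict_right_mono) auto
  also have "\<dots> = 1 / 5 * kappa2 ^ (2 ^ n - 1)"
    unfolding p' by (simp add: power_mult)
  finally have "w * ?d n < 1 / 5 * kappa2 ^ (2 ^ n - 1)" .
  moreover have "0 < w * ?d n" using lambert_rel_err_range[of w n] w by simp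
  moreover have "kappa2 ^ Suc (2 * p) < (633 / 1000) ^ Suc (2 * p)"
    using kappa2_bounds k by (intro power_strict_mono) auto
  ultimately show ?thesis unfolding err p' by simp
qed

end
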